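(* Let $c\in(0,1)$, $\beta>0$ and $n\in\mathbb{N}$. The best constant $\gamma_n(c,\beta)=\sup\{\|\Delta f\|_{c,\beta}: f\in\mathcal{P}_n,\ \|f\|_{c,\beta}=1\}$ in the Markov–Bernstein inequality $$\|\Delta p\|_{c,\beta}\le\gamma_n\,\|p\|_{c,\beta},\qquad p\in\mathcal{P}_n,$$ admits the representation $$\gamma_n(c,\beta)=\frac{1/c-1}{\sqrt{\lambda_{\min}(c,\beta)}},$$ where $\lambda_{\min}(c,\beta)>0$ is the smallest eigenvalue of either of the matrices $\mathbf{B}_n$, $\widetilde{\mathbf{B}}_n$, $\mathbf{C}_n$ and $\widetilde{\mathbf{C}}_n$.
   Context: $\mathcal{P}_n$ is the set of real algebraic polynomials of degree at most $n$; $\Delta f(x):=f(x+1)-f(x)$. For $c\in(0,1)$, $\beta>0$, the Meixner norm is $\|f\|_{c,\beta}=\big(\sum_{k=0}^{\infty}\frac{(\beta)_k}{k!}c^k[f(k)]^2\big)^{1/2}$, where $(\beta)_k=\beta(\beta+1)\cdots(\beta+k-1)$ for $k\ge1$ and $(\beta)_0=1$. The matrices are real symmetric tridiagonal $n\times n$ matrices, depending on $c$ and $\beta$. $\mathbf{B}_n=(b_{i,j})$ has diagonal entries $b_{k,k}=\frac{\beta+k-1}{kc}+1$ for $k=1,\ldots,n-1$, and $b_{n,n}=\frac{\beta+n-1}{nc}$, and off-diagonal entries $b_{k,k+1}=b_{k+1,k}=-\sqrt{\frac{\beta+k}{(k+1)c}}$ for $k=1,\ldots,n-1$. $\mathbf{C}_n=(c_{i,j})$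 has diagonal entries $c_{1,1}=\frac{\beta}{c}$ and $c_{k,k}=\frac{\beta+k-1}{kc}+1$ for $k=2,\ldots,n$, and off-diagonal entries $c_{k,k+1}=c_{k+1,k}=-\sqrt{\frac{\beta+k-1}{kc}}$ for $k=1,\ldots,n-1$. All other entries are $0$. $\widetilde{\mathbf{B}}_n$ and $\widetilde{\mathbf{C}}_n$ are the matrices whose diagonal entries coincide with those of $\mathbf{B}_n$ and $\mathbf{C}_n$, respectively, and whose off-diagonal entries are the negatives of those of $\mathbf{B}_n$ and $\mathbf{C}_n$, respectively. *)

theory Defs
  imports Complex_Main "Jordan_Normal_Form.Char_Poly"
begin

definition poly_space :: "nat \<Rightarrow> (real \<Rightarrow> real) set" where
  "poly_space n = {poly p | p :: real poly. degree p \<le> n}"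

definition fwd_diff :: "(real \<Rightarrow> real) \<Rightarrow> real \<Rightarrow> real" where
  "fwd_diff f = (\<lambda>x. f (x + 1) - f x)"

definition meixner_norm :: "real \<Rightarrow> real \<Rightarrow> (real \<Rightarrow> real) \<Rightarrow> real" where
  "meixner_norm c \<beta> f = sqrt (\<Sum>k. pochhammer \<beta> k / fact k * c ^ k * (f (real k))\<^sup>2)"

(* A real-valued Sup, hence only meaningful if the set is bounded above; the boundedness
   amounts to the Markov-Bernstein inequality with this constant. *)
definition markov_bernstein_const :: "nat \<Rightarrow> real \<Rightarrow> real \<Rightarrow> real" where
  "markov_bernstein_const n c \<beta> =
     Sup {meixner_norm c \<beta> (fwd_diff f) | f. f \<in> poly_space n \<and> meixner_norm c \<beta> f = 1}"

text \<open>
  The entry functions use the indices \<open>1, \<dots>, n\<close>; matrices in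
  \<open>Jordan_Normal_Form\<close> are indexed from 0, hence the shifts by \<open>Suc\<close>.
\<close>

definition B_entry :: "nat \<Rightarrow> real \<Rightarrow> real \<Rightarrow> nat \<Rightarrow> nat \<Rightarrow> real" where
  "B_entry n c \<beta> i j =
     (if i = j then
        (if i = n then (\<beta> + real n - 1) / (real n * c)
         else (\<beta> + real i - 1) / (real i * c) + 1)
      else if j = i + 1 then - sqrt ((\<beta> + real i) / ((real i + 1) * c))
      else if i = j + 1 then - sqrt ((\<beta> + real j) / ((real j + 1) * c))
      else 0)"

definition C_entry :: "real \<Rightarrow> real \<Rightarrow> nat \<Rightarrow> nat \<Rightarrow> real" where
  "C_entry c \<beta> i j =
     (if i = j then
        (if i = 1 then \<beta> / c
         else (\<beta> + real i - 1) / (real i * c) + 1)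
      else if j = i + 1 then - sqrt ((\<beta> + real i - 1) / (real i * c))
      else if i = j + 1 then - sqrt ((\<beta> + real j - 1) / (real j * c))
      else 0)"

definition B_mat :: "nat \<Rightarrow> real \<Rightarrow> real \<Rightarrow> real mat" where
  "B_mat n c \<beta> = mat n n (\<lambda>(i, j). B_entry n c \<beta> (Suc i) (Suc j))"

definition C_mat :: "nat \<Rightarrow> real \<Rightarrow> real \<Rightarrow> real mat" where
  "C_mat n c \<beta> = mat n n (\<lambda>(i, j). C_entry c \<beta> (Suc i) (Suc j))"

definition negate_offdiag :: "real mat \<Rightarrow> real mat" where
  "negate_offdiag A =
     mat (dim_row A) (dim_col A) (\<lambda>(i, j). if i = j then A $$ (i, j) else - (A $$ (i, j)))"

definition smallest_eigenvalue :: "real mat \<Rightarrow> real \<Rightarrow> bool" where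
  "smallest_eigenvalue A l \<longleftrightarrow> eigenvalue A l \<and> (\<forall>\<mu>. eigenvalue A \<mu> \<longrightarrow> l \<le> \<mu>)"

text \<open>
  The series defining the norm converges for every polynomial, so
  \<open>meixner_norm\<close> takes no junk values on \<open>poly_space n\<close>.
\<close>

lemma summable_meixner_power:
  assumes c: "0 < c" "c < 1" and \<beta>: "\<beta> > 0"
  shows "summable (\<lambda>k. pochhammer \<beta> k / fact k * c ^ k * real k ^ i)"
proof -
  define a where "a = (\<lambda>k. pochhammer \<beta> k / fact k * c ^ k * real k ^ i)"
  define r where "r = (\<lambda>k::nat. (1 + (\<beta> - 1) * inverse (real (Suc k))) * c *
                      (1 + inverse (real k)) ^ i)"
  have inv: "(\<lambda>k. inverse (real k)) \<longlonglongrightarrow> 0"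
    using LIMSEQ_inverse_real_of_nat by (subst (asm) filterlim_sequentially_Suc)
  have "r \<longlonglongrightarrow> (1 + (\<beta> - 1) * 0) * c * (1 + 0) ^ i"
    unfolding r_def by (intro tendsto_intros LIMSEQ_inverse_real_of_nat inv)
  hence lim: "r \<longlonglongrightarrow> c" by simp
  obtain d where d: "c < d" "d < 1" using c dense by blast
  have "eventually (\<lambda>k. r k < d) sequentially"
    using lim d by (intro order_tendstoD)
  then obtain N where N: "\<And>k. k \<ge> N \<Longrightarrow> r k < d"
    unfolding eventually_sequentially by blast
  have pos: "a k \<ge> 0" for k
    using c \<beta> by (auto simp: a_def intro!: mult_nonneg_nonneg divide_nonneg_nonneg pochhammer_nonneg)
  have step: "a (Suc k) = r k * a k" if "k \<ge> 1" for k
  proof -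
    have 1: "real (Suc k) = (1 + inverse (real k)) * real k"
      using that by (simp add: field_simps)
    have 2: "real (Suc k) ^ i = (1 + inverse (real k)) ^ i * real k ^ i"
      unfolding 1 by (rule power_mult_distrib)
    have 3: "(\<beta> + real k) / real (Suc k) = 1 + (\<beta> - 1) * inverse (real (Suc k))"
      by (simp add: field_simps)
    have "a (Suc k) = (\<beta> + real k) / real (Suc k) * c * (pochhammer \<beta> k / fact k * c ^ k)
                       * real (Suc k) ^ i"
      by (simp add: a_def pochhammer_Suc)
    thus ?thesis unfolding 2 3 by (simp add: a_def r_def)
  qed
  have "summable a"
  proof (rule summable_ratio_test[OF d(2), of "max 1 N"])
    fix k assume k: "k \<ge> max 1 N"
    have "r k * a k \<le> d * a k"
      using N[of k] k pos[of k] by (intro mult_right_mono) auto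
    thus "norm (a (Suc k)) \<le> d * norm (a k)"
      using step[of k] k pos[of k] pos[of "Suc k"] by simp
  qed
  thus ?thesis by (simp add: a_def)
qed

lemma summable_meixner_norm:
  assumes c: "0 < c" "c < 1" and \<beta>: "\<beta> > 0" and f: "f \<in> poly_space n"
  shows "summable (\<lambda>k. pochhammer \<beta> k / fact k * c ^ k * (f (real k))\<^sup>2)"
proof -
  obtain p where p: "f = poly p" using f by (auto simp: poly_space_def)
  have "pochhammer \<beta> k / fact k * c ^ k * (f (real k))\<^sup>2 =
        (\<Sum>i\<le>degree (p ^ 2). coeff (p ^ 2) i * (pochhammer \<beta> k / fact k * c ^ k * real k ^ i))" for k
  proof -
    have "(f (real k))\<^sup>2 = poly (p ^ 2) (real k)" by (simp add: p)
    also have "\<dots> = (\<Sum>i\<le>degree (p ^ 2). coeff (p ^ 2) i * real k ^ i)"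
      by (rule poly_altdef)
    finally show ?thesis
      by (simp only: sum_distrib_left mult_ac)
  qed
  thus ?thesis
    by (simp only:) (intro summable_sum summable_mult summable_meixner_power c \<beta>)
qed

lemma fwd_diff_poly_space:
  assumes "f \<in> poly_space n"
  shows "fwd_diff f \<in> poly_space n"
proof -
  obtain p where p: "f = poly p" "degree p \<le> n" using assms by (auto simp: poly_space_def)
  have "fwd_diff f = poly (pcompose p [:1, 1:] - p)"
    by (auto simp: fwd_diff_def p poly_pcompose add.commute)
  moreover have "degree (pcompose p [:1, 1:] - p) \<le> n"
    using p(2) by (intro degree_diff_le) (auto simp: degree_pcompose)
  ultimately show ?thesis by (auto simp: poly_space_def)
qed

end

theory Submission
  imports Defs "HOL-Analysis.Function_Topology"
begin

text \<open>
  Let \<open>L\<^sub>k\<close> be the Meixner polynomials normalised by \<open>\<Sum>k. L\<^sub>k(x) t\<^sup>k = (1 - t / c)\<^sup>x (1 - t)\<^sup>-\<^sup>x\<^sup>-\<^sup>\<beta>\<close>.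
  They are orthogonal and satisfy \<open>\<Delta>L\<^sub>k = -(1 / c - 1) (\<Sum>j<k. L\<^sub>j)\<close>, so in the orthonormalised basis
  the ratio \<open>\<parallel>f\<parallel>\<^sup>2 / \<parallel>\<Delta>f\<parallel>\<^sup>2\<close> is, for the optimal constant term of \<open>f\<close>, the Rayleigh quotient of
  \<open>D\<^sup>T D\<close> divided by \<open>(1 / c - 1)\<^sup>2\<close>, where \<open>D\<close> is upper bidiagonal. Now \<open>C = D\<^sup>T D\<close> and \<open>B = D D\<^sup>T\<close>
  have the same eigenvalues, and conjugation with \<open>diag(1, -1, 1, \<dots>)\<close> flips the off-diagonal signs.
\<close>

section \<open>Rayleigh quotients of real symmetric matrices\<close>

lemma scalar_prod_self_eq_0_iff:
  fixes v :: "real vec"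
  assumes "v \<in> carrier_vec n"
  shows "v \<bullet> v = 0 \<longleftrightarrow> v = 0\<^sub>v n"
proof -
  have "v \<bullet> v = 0 \<longleftrightarrow> (\<forall>i<n. v $ i = 0)"
    using assms by (auto simp: scalar_prod_def sum_nonneg_eq_0_iff)
  also have "\<dots> \<longleftrightarrow> v = 0\<^sub>v n"
    using assms by (auto intro!: eq_vecI)
  finally show ?thesis .
qed

lemma scalar_prod_self_nonneg:
  fixes v :: "real vec"
  shows "v \<bullet> v \<ge> 0"
  by (auto simp: scalar_prod_def intro!: sum_nonneg)

lemma scalar_prod_self_pos:
  fixes v :: "real vec"
  assumes "v \<in> carrier_vec n" "v \<noteq> 0\<^sub>v n"
  shows "v \<bullet> v > 0"
  using scalar_prod_self_eq_0_iff[OF assms(1)] scalar_prod_self_nonneg[of v] assms(2) by linarith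

text \<open>The unit sphere is compact and the quadratic form continuous, so a minimum is attained;
  homogeneity extends the bound from unit vectors to all \<open>y\<close>. Vectors become functions
  \<open>nat \<Rightarrow> real\<close> so that Tychonoff's theorem supplies the
  compactness.\<close>

lemma quadratic_form_attains_min:
  fixes A :: "real mat"
  assumes A: "A \<in> carrier_mat n n" and n: "n > 0"
  obtains v where "v \<in> carrier_vec n" "v \<bullet> v = 1"
    "\<And>y. y \<in> carrier_vec n \<Longrightarrow> (v \<bullet> (A *\<^sub>v v)) * (y \<bullet> y) \<le> y \<bullet> (A *\<^sub>v y)"
proof -
  define N where "N = (\<lambda>f::nat \<Rightarrow> real. \<Sum>i\<in>{0..<n}. f i * f i)"
  define Q where "Q = (\<lambda>f::nat \<Rightarrow> real. \<Sum>i\<in>{0..<n}. f i * (\<Sum>j\<in>{0..<n}. A $$ (i,j) * f j))"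
  \<comment> \<open>Only the coordinates below \<open>n\<close> matter; the others are merely confined to a compact interval.\<close>
  define S where "S = PiE UNIV (\<lambda>_::nat. {-1..1::real}) \<inter> {f. N f = 1}"
  have N_vec: "vec n f \<bullet> vec n f = N f" for f
    by (simp add: N_def scalar_prod_def)
  have Q_vec: "vec n f \<bullet> (A *\<^sub>v vec n f) = Q f" for f
    using A by (simp add: Q_def scalar_prod_def)
  have cont: "continuous_on X N" "continuous_on X Q" for X
    unfolding N_def Q_def
    by (intro continuous_intros continuous_on_subset[OF continuous_on_product_coordinates]; simp)+
  have "compactin euclidean (PiE UNIV (\<lambda>_::nat. {-1..1::real}))"
    unfolding euclidean_product_topology[symmetric] compactin_PiE by simp
  moreover have "closed {f. N f = 1}"
    using cont(1) by (intro closed_Collect_eq) auto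
  ultimately have "compact S"
    unfolding S_def by (simp add: compact_Int_closed)
  \<comment> \<open>The first unit vector witnesses that \<open>S\<close> is nonempty; this is where
    \<open>n > 0\<close> enters.\<close>
  moreover have "(\<lambda>i. if i = 0 then 1 else 0) \<in> S"
    using n by (auto simp: S_def N_def if_distrib[of "\<lambda>x. x * _"] cong: if_cong)
  ultimately obtain f where f: "f \<in> S" and min: "\<And>g. g \<in> S \<Longrightarrow> Q f \<le> Q g"
    using continuous_attains_inf[of S Q] cont(2) by blast
  have "Q f * (y \<bullet> y) \<le> y \<bullet> (A *\<^sub>v y)" if y: "y \<in> carrier_vec n" for y
  proof (cases "y = 0\<^sub>v n")
    case True
    thus ?thesis using A by auto
  next
    case False
    define r where "r = sqrt (y \<bullet> y)"
    have r: "r > 0" "y \<bullet> y = r * r"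
      using scalar_prod_self_pos[OF y False] by (auto simp: r_def)
    define g where "g = (\<lambda>i. if i < n then y $ i / r else 0)"
    have y_eq: "y = r \<cdot>\<^sub>v vec n g"
      using y r by (auto simp: g_def intro!: eq_vecI)
    have "r * r * N g = r * r"
      using r(2) unfolding y_eq by (simp add: N_vec)
    hence Ng: "N g = 1" using r by simp
    have "g i \<in> {-1..1}" for i
    proof (cases "i < n")
      case True
      have "g i * g i \<le> N g"
        unfolding N_def using True by (intro member_le_sum) auto
      hence "(g i)\<^sup>2 \<le> 1" by (simp add: Ng power2_eq_square)
      thus ?thesis by (auto simp: abs_square_le_1 abs_le_iff)
    qed (simp add: g_def)
    hence "g \<in> S" using Ng by (auto simp: S_def)
    hence "r * r * Q f \<le> r * r * Q g"
      using min r by (intro mult_left_mono) auto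
    also have "r * r * Q g = y \<bullet> (A *\<^sub>v y)"
      unfolding y_eq Q_vec[symmetric] using A by (simp add: mult_mat_vec[OF A])
    finally show ?thesis using r by (simp add: mult.commute)
  qed
  thus ?thesis
    using f by (intro that[of "vec n f"]) (auto simp: S_def N_vec Q_vec)
qed

text \<open>A minimiser \<open>v\<close> of the Rayleigh quotient is a critical point, and for
  symmetric \<open>A\<close> the gradient at a unit vector is a multiple of
  \<open>A v - l v\<close>, which must therefore vanish.\<close>

lemma symmetric_mat_min_eigenvalue:
  fixes A :: "real mat"
  assumes A: "A \<in> carrier_mat n n" and sym: "transpose_mat A = A" and n: "n > 0"
  obtains l v where "eigenvector A v l"
    "\<And>y. y \<in> carrier_vec n \<Longrightarrow> l * (y \<bullet> y) \<le> y \<bullet> (A *\<^sub>v y)"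
proof -
  obtain v where v: "v \<in> carrier_vec n" "v \<bullet> v = 1" and
    min: "\<And>y. y \<in> carrier_vec n \<Longrightarrow> (v \<bullet> (A *\<^sub>v v)) * (y \<bullet> y) \<le> y \<bullet> (A *\<^sub>v y)"
    using quadratic_form_attains_min[OF A n] by blast
  define l where "l = v \<bullet> (A *\<^sub>v v)"
  have Av: "A *\<^sub>v v \<in> carrier_vec n" using A v by auto
  \<comment> \<open>First variation of the Rayleigh quotient at \<open>v\<close> in the direction \<open>z\<close> of its gradient.\<close>
  define z where "z = A *\<^sub>v v - l \<cdot>\<^sub>v v"
  have z: "z \<in> carrier_vec n" and Az: "A *\<^sub>v z \<in> carrier_vec n"
    using A v by (auto simp: z_def)
  define K where "K = z \<bullet> (A *\<^sub>v z) - l * (z \<bullet> z)"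
  \<comment> \<open>Symmetry makes the two cross terms of the expanded quadratic form equal.\<close>
  have vAz: "v \<bullet> (A *\<^sub>v z) = z \<bullet> (A *\<^sub>v v)"
    using transpose_vec_mult_scalar[OF A z v(1)] sym comm_scalar_prod[OF z Av] by simp
  have zz: "z \<bullet> z = z \<bullet> (A *\<^sub>v v) - l * (z \<bullet> v)"
    using scalar_prod_minus_distrib[OF z Av, of "l \<cdot>\<^sub>v v"] z v by (simp add: z_def)
  have zv: "v \<bullet> z = z \<bullet> v" by (rule comm_scalar_prod[OF v(1) z])
  have var: "0 \<le> 2 * t * (z \<bullet> z) + t * t * K" for t
  proof -
    have tz: "t \<cdot>\<^sub>v z \<in> carrier_vec n" using z by simp
    have ws: "x \<bullet> (v + t \<cdot>\<^sub>v z) = x \<bullet> v + t * (x \<bullet> z)" if "x \<in> carrier_vec n" for x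
      using that v z by (simp add: scalar_prod_add_distrib[OF that v(1) tz])
    have sw: "(v + t \<cdot>\<^sub>v z) \<bullet> x = v \<bullet> x + t * (z \<bullet> x)" if "x \<in> carrier_vec n" for x
      using that v z by (simp add: add_scalar_prod_distrib[OF v(1) tz that])
    have Aw: "A *\<^sub>v (v + t \<cdot>\<^sub>v z) = A *\<^sub>v v + t \<cdot>\<^sub>v (A *\<^sub>v z)"
      using mult_add_distrib_mat_vec[OF A v(1) tz] mult_mat_vec[OF A z] by simp
    have "(v + t \<cdot>\<^sub>v z) \<bullet> (A *\<^sub>v (v + t \<cdot>\<^sub>v z)) =
          v \<bullet> (A *\<^sub>v v) + t * (v \<bullet> (A *\<^sub>v z)) + t * (z \<bullet> (A *\<^sub>v v) + t * (z \<bullet> (A *\<^sub>v z)))"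
      using v z Av Az tz
      by (simp add: Aw sw scalar_prod_add_distrib[of _ n] distrib_left)
    moreover have "(v + t \<cdot>\<^sub>v z) \<bullet> (v + t \<cdot>\<^sub>v z) = 1 + t * (v \<bullet> z) + t * (z \<bullet> v + t * (z \<bullet> z))"
      using v z tz by (simp add: sw ws distrib_left)
    moreover have "l * ((v + t \<cdot>\<^sub>v z) \<bullet> (v + t \<cdot>\<^sub>v z)) \<le> (v + t \<cdot>\<^sub>v z) \<bullet> (A *\<^sub>v (v + t \<cdot>\<^sub>v z))"
      unfolding l_def using v tz by (intro min) auto
    ultimately have "0 \<le> 2 * t * (z \<bullet> (A *\<^sub>v v) - l * (z \<bullet> v)) + t * t * K"
      unfolding K_def vAz zv l_def[symmetric] by (simp add: algebra_simps)
    thus ?thesis by (simp only: zz)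
  qed
  have "z \<bullet> z = 0"
  proof (rule ccontr)
    assume "z \<bullet> z \<noteq> 0"
    hence pos: "z \<bullet> z > 0" using scalar_prod_self_nonneg[of z] by linarith
    \<comment> \<open>A step so short that at \<open>t = - s\<close> the linear term of
      \<open>var\<close> outweighs the quadratic one and the right-hand side becomes
      negative.\<close>
    define s where "s = (z \<bullet> z) / (\<bar>K\<bar> + 1)"
    have s: "s > 0" "s * (\<bar>K\<bar> + 1) = z \<bullet> z"
      using pos by (simp_all add: s_def)
    have "s * K \<le> s * (\<bar>K\<bar> + 1)" using s(1) by (intro mult_left_mono) auto
    hence "s * K - 2 * (z \<bullet> z) < 0" using s(2) pos by linarith
    hence "s * (s * K - 2 * (z \<bullet> z)) < 0" using s(1) by (simp add: mult_pos_neg)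
    thus False using var[of "- s"] by (simp add: algebra_simps)
  qed
  hence "z = 0\<^sub>v n" using scalar_prod_self_eq_0_iff[OF z] by simp
  have "A *\<^sub>v v = l \<cdot>\<^sub>v v"
  proof (rule eq_vecI)
    fix i assume "i < dim_vec (l \<cdot>\<^sub>v v)"
    hence i: "i < n" using v by simp
    have "z $ i = (A *\<^sub>v v) $ i - (l \<cdot>\<^sub>v v) $ i"
      unfolding z_def by (rule index_minus_vec) (use i v in simp)
    thus "(A *\<^sub>v v) $ i = (l \<cdot>\<^sub>v v) $ i"
      using i by (simp add: \<open>z = 0\<^sub>v n\<close> del: index_mult_mat_vec)
  qed (use A v in auto)
  moreover have "v \<noteq> 0\<^sub>v n" using v by auto
  ultimately have "eigenvector A v l"
    using A v by (auto simp: eigenvector_def)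
  thus ?thesis using min by (intro that[of v l]) (simp_all add: l_def)
qed

section \<open>Spectra of \<open>A * B\<close> and \<open>B * A\<close>\<close>

text \<open>\<open>B\<close> carries an eigenvector of \<open>A * B\<close> to one of
  \<open>B * A\<close>; \<open>\<mu> \<noteq> 0\<close> guarantees that the image is
  nonzero.\<close>

lemma eigenvalue_mult_commute:
  fixes A B :: "real mat"
  assumes A: "A \<in> carrier_mat n n" and B: "B \<in> carrier_mat n n"
    and ev: "eigenvalue (A * B) \<mu>" and \<mu>: "\<mu> \<noteq> 0"
  shows "eigenvalue (B * A) \<mu>"
proof -
  obtain v where v: "v \<in> carrier_vec n" "v \<noteq> 0\<^sub>v n" "(A * B) *\<^sub>v v = \<mu> \<cdot>\<^sub>v v"
    using ev A by (auto simp: eigenvalue_def eigenvector_def)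
  have ABv: "A *\<^sub>v (B *\<^sub>v v) = \<mu> \<cdot>\<^sub>v v" using v A B by simp
  have "B *\<^sub>v v \<noteq> 0\<^sub>v n"
  proof
    assume "B *\<^sub>v v = 0\<^sub>v n"
    moreover have "A *\<^sub>v 0\<^sub>v n = 0\<^sub>v n" using A by (auto intro!: eq_vecI)
    ultimately have "\<mu> \<cdot>\<^sub>v v = 0\<^sub>v n" using ABv by simp
    hence "\<mu> * v $ i = 0" if "i < n" for i
      using that v(1) by (metis carrier_vecD index_smult_vec(1) index_zero_vec(1))
    hence "v = 0\<^sub>v n" using \<mu> v(1) by (intro eq_vecI) auto
    thus False using v by simp
  qed
  moreover have "(B * A) *\<^sub>v (B *\<^sub>v v) = \<mu> \<cdot>\<^sub>v (B *\<^sub>v v)"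
    using A B v ABv by (simp add: mult_mat_vec[OF B])
  ultimately show ?thesis
    using A B v by (auto simp: eigenvalue_def eigenvector_def intro!: exI[of _ "B *\<^sub>v v"])
qed

lemma not_eigenvalue_0:
  fixes A :: "real mat"
  assumes A: "A \<in> carrier_mat n n" and det: "det A \<noteq> 0"
  shows "\<not> eigenvalue A 0"
proof
  assume "eigenvalue A 0"
  then obtain v where "v \<in> carrier_vec n" "v \<noteq> 0\<^sub>v n" "A *\<^sub>v v = 0 \<cdot>\<^sub>v v"
    using A by (auto simp: eigenvalue_def eigenvector_def)
  moreover from this have "0 \<cdot>\<^sub>v v = 0\<^sub>v n" by (auto intro!: eq_vecI)
  ultimately show False using det det_0_iff_vec_prod_zero[OF A] by metis
qed

text \<open>The eigenvalue 0, which the transfer of eigenvectors leaves open, is excluded on both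
  sides by the determinant.\<close>

lemma eigenvalue_mult_commute_iff:
  fixes A B :: "real mat"
  assumes A: "A \<in> carrier_mat n n" and B: "B \<in> carrier_mat n n" and det: "det (A * B) \<noteq> 0"
  shows "eigenvalue (A * B) \<mu> \<longleftrightarrow> eigenvalue (B * A) \<mu>"
proof -
  have "det (B * A) \<noteq> 0" using det by (simp add: det_mult[OF A B] det_mult[OF B A])
  hence "\<not> eigenvalue (A * B) 0" "\<not> eigenvalue (B * A) 0"
    using det not_eigenvalue_0[OF mult_carrier_mat[OF A B]] not_eigenvalue_0[OF mult_carrier_mat[OF B A]]
    by blast+
  thus ?thesis
    using eigenvalue_mult_commute[OF A B] eigenvalue_mult_commute[OF B A] by (cases "\<mu> = 0") auto
qed

section \<open>Sign changes in tridiagonal matrices\<close>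

definition tridiagonal :: "real mat \<Rightarrow> bool" where
  "tridiagonal A \<longleftrightarrow>
     (\<forall>i<dim_row A. \<forall>j<dim_col A. i \<noteq> j \<longrightarrow> i \<noteq> Suc j \<longrightarrow> j \<noteq> Suc i \<longrightarrow> A $$ (i, j) = 0)"

text \<open>Conjugation by \<open>diag(1, -1, 1, ...)\<close> multiplies entry \<open>(i, j)\<close>
  by \<open>(-1) ^ (i + j)\<close>, which is \<open>-1\<close> right beside the diagonal; the
  entries farther out are zero.\<close>

lemma eigenvalue_negate_offdiag_imp:
  fixes A :: "real mat"
  assumes A: "A \<in> carrier_mat n n" and tri: "tridiagonal A" and ev: "eigenvalue A \<mu>"
  shows "eigenvalue (negate_offdiag A) \<mu>"
proof -
  obtain v where v: "v \<in> carrier_vec n" "v \<noteq> 0\<^sub>v n" "A *\<^sub>v v = \<mu> \<cdot>\<^sub>v v"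
    using ev A by (auto simp: eigenvalue_def eigenvector_def)
  define u where "u = vec n (\<lambda>i. (-1) ^ i * v $ i)"
  have u: "u \<in> carrier_vec n" by (simp add: u_def)
  have neg: "negate_offdiag A \<in> carrier_mat n n" using A by (auto simp: negate_offdiag_def)
  have entry: "negate_offdiag A $$ (i, j) * (-1) ^ j = (-1) ^ i * A $$ (i, j)"
    if ij: "i < n" "j < n" for i j
  proof -
    consider "i = j" | "i = Suc j" | "j = Suc i" | "A $$ (i, j) = 0" "i \<noteq> j"
      using ij A tri unfolding tridiagonal_def by (metis carrier_matD)
    thus ?thesis using ij A by cases (auto simp: negate_offdiag_def)
  qed
  have "negate_offdiag A *\<^sub>v u = \<mu> \<cdot>\<^sub>v u"
  proof (rule eq_vecI)
    fix i assume "i < dim_vec (\<mu> \<cdot>\<^sub>v u)"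
    hence i: "i < n" by (simp add: u_def)
    have "(negate_offdiag A *\<^sub>v u) $ i = (\<Sum>j\<in>{0..<n}. (negate_offdiag A $$ (i, j) * (-1) ^ j) * v $ j)"
      using neg i by (simp add: scalar_prod_def u_def mult.assoc)
    also have "\<dots> = (\<Sum>j\<in>{0..<n}. (-1) ^ i * (A $$ (i, j) * v $ j))"
      using i by (intro sum.cong) (auto simp: entry)
    also have "\<dots> = (-1) ^ i * (A *\<^sub>v v) $ i"
      using A i v(1) by (simp add: scalar_prod_def sum_distrib_left)
    also have "\<dots> = (\<mu> \<cdot>\<^sub>v u) $ i"
      using v i by (simp add: u_def)
    finally show "(negate_offdiag A *\<^sub>v u) $ i = (\<mu> \<cdot>\<^sub>v u) $ i" .
  qed (use neg u in auto)
  moreover have "u \<noteq> 0\<^sub>v n"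
  proof
    assume "u = 0\<^sub>v n"
    hence "v $ i = 0" if "i < n" for i
      using that by (metis index_vec index_zero_vec(1) mult_eq_0_iff power_eq_0_iff u_def
          zero_neq_neg_one)
    thus False using v by (auto intro!: eq_vecI)
  qed
  ultimately show ?thesis
    using u neg by (auto simp: eigenvalue_def eigenvector_def intro!: exI[of _ u])
qed

text \<open>\<open>negate_offdiag\<close> is an involution that keeps the matrix tridiagonal, so one
  implication gives both.\<close>

lemma eigenvalue_negate_offdiag_iff:
  fixes A :: "real mat"
  assumes A: "A \<in> carrier_mat n n" and tri: "tridiagonal A"
  shows "eigenvalue (negate_offdiag A) \<mu> \<longleftrightarrow> eigenvalue A \<mu>"
proof -
  have "negate_offdiag A \<in> carrier_mat n n" "tridiagonal (negate_offdiag A)"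
    "negate_offdiag (negate_offdiag A) = A"
    using A tri by (auto simp: negate_offdiag_def tridiagonal_def)
  thus ?thesis
    using eigenvalue_negate_offdiag_imp[OF A tri] eigenvalue_negate_offdiag_imp[of "negate_offdiag A"]
    by metis
qed

hide_const (open) Module.smult

section \<open>The Meixner weight and its moment functional\<close>

locale meixner =
  fixes c \<beta> :: real
  assumes c_pos: "0 < c" and c_less_1: "c < 1" and \<beta>_pos: "0 < \<beta>"
begin

definition weight :: "nat \<Rightarrow> real" where
  "weight k = pochhammer \<beta> k / fact k * c ^ k"

text \<open>The inner product of \<open>p\<close> and \<open>q\<close> is
  \<open>moment (p * q)\<close>, which makes the symmetry of multiplication by \<open>x\<close> a
  matter of commutativity.\<close>

definition moment :: "real poly \<Rightarrow> real" where
  "moment p = (\<Sum>k. weight k * poly p (real k))"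

lemma weight_pos: "weight k > 0"
  using c_pos \<beta>_pos by (simp add: weight_def pochhammer_pos)

text \<open>The Pearson difference equation of the weight.\<close>

lemma weight_Suc: "weight (Suc k) * real (Suc k) = c * (\<beta> + real k) * weight k"
  by (simp add: weight_def pochhammer_Suc)

lemma summable_weight_poly: "summable (\<lambda>k. weight k * poly p (real k))"
proof -
  have "weight k * poly p (real k) =
        (\<Sum>i\<le>degree p. coeff p i * (pochhammer \<beta> k / fact k * c ^ k * real k ^ i))" for k
    by (simp add: poly_altdef weight_def sum_distrib_left mult_ac)
  thus ?thesis
    by (simp only:)
      (intro summable_sum summable_mult summable_meixner_power c_pos c_less_1 \<beta>_pos)
qed

lemma moment_add: "moment (p + q) = moment p + moment q"
  unfolding moment_def poly_add distrib_left
  by (rule suminf_add[symmetric, OF summable_weight_poly summable_weight_poly])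

lemma moment_smult: "moment (smult a p) = a * moment p"
  unfolding moment_def poly_smult mult.left_commute[of _ a]
  by (rule suminf_mult[OF summable_weight_poly])

lemma moment_diff: "moment (p - q) = moment p - moment q"
  unfolding moment_def poly_diff right_diff_distrib
  by (rule suminf_diff[symmetric, OF summable_weight_poly summable_weight_poly])

lemma moment_0 [simp]: "moment 0 = 0"
  by (simp add: moment_def)

lemma moment_sum: "moment (\<Sum>i\<in>I. f i) = (\<Sum>i\<in>I. moment (f i))"
  by (induction I rule: infinite_finite_induct) (auto simp: moment_add)

lemma moment_1_pos: "moment 1 > 0"
  unfolding moment_def using summable_weight_poly[of 1] by (intro suminf_pos) (auto simp: weight_pos)

text \<open>The Pearson equation summed against \<open>p\<close>. The factor \<open>x\<close> kills
  the term at 0, so the summation index can be shifted by one.\<close>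

lemma moment_pearson:
  "moment ([:0, 1:] * p) = c * moment ([:\<beta>, 1:] * pcompose p [:1, 1:])"
proof -
  have "(\<Sum>k. weight (Suc k) * poly ([:0, 1:] * p) (real (Suc k))) = moment ([:0, 1:] * p)"
    using suminf_split_head[OF summable_weight_poly[of "[:0, 1:] * p"]] by (simp add: moment_def)
  moreover have "weight (Suc k) * poly ([:0, 1:] * p) (real (Suc k)) =
      c * (weight k * poly ([:\<beta>, 1:] * pcompose p [:1, 1:]) (real k))" for k
  proof -
    have "weight (Suc k) * poly ([:0, 1:] * p) (real (Suc k)) =
          (weight (Suc k) * real (Suc k)) * poly p (real (Suc k))"
      by simp
    also have "\<dots> = c * (weight k * poly ([:\<beta>, 1:] * pcompose p [:1, 1:]) (real k))"
      unfolding weight_Suc by (simp add: poly_pcompose algebra_simps)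
    finally show ?thesis .
  qed
  ultimately show ?thesis
    unfolding moment_def by (simp only: suminf_mult[OF summable_weight_poly])
qed

lemma meixner_norm_poly: "meixner_norm c \<beta> (poly p) = sqrt (moment (p * p))"
  by (simp add: meixner_norm_def moment_def weight_def power2_eq_square)

section \<open>Meixner polynomials and their behaviour under the shift by 1\<close>

definition kappa :: real ("\<kappa>") where "\<kappa> = 1 / c - 1"

lemma kappa_pos: "\<kappa> > 0"
  using c_pos c_less_1 by (simp add: kappa_def)

lemma c_kappa: "c * \<kappa> = 1 - c"
  using c_pos by (simp add: kappa_def right_diff_distrib)

text \<open>
  In the usual notation \<open>L k\<close> is \<open>(\<beta>)\<^sub>k / k!\<close> times the Meixner polynomial \<open>M\<^sub>k(x; \<beta>, c)\<close>.
  The recurrence comes from the logarithmic derivative in \<open>t\<close> of the generating function.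
\<close>
fun L :: "nat \<Rightarrow> real poly" where
  "L 0 = 1"
| "L (Suc 0) = [:\<beta>, -\<kappa>:]"
| "L (Suc (Suc k)) = smult (1 / real (k + 2))
     ([:\<beta> + (1 + 1 / c) * real (k + 1), -\<kappa>:] * L (Suc k) - smult ((\<beta> + real k) / c) (L k))"

lemma L_rec:
  "smult (real (k + 2)) (L (Suc (Suc k))) =
     [:\<beta> + (1 + 1 / c) * real (k + 1), -\<kappa>:] * L (Suc k) - smult ((\<beta> + real k) / c) (L k)"
  by simp

lemma poly_L_rec:
  "real (k + 2) * poly (L (Suc (Suc k))) x =
     (\<beta> + (1 + 1 / c) * real (k + 1) - \<kappa> * x) * poly (L (Suc k)) x - (\<beta> + real k) / c * poly (L k) x"
  using arg_cong[OF L_rec[of k], of "\<lambda>p. poly p x"] by (simp add: algebra_simps del: L.simps)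

text \<open>Each step of the recurrence multiplies the leading coefficient by a nonzero multiple of
  \<open>\<kappa>\<close>; exact degrees make the \<open>L k\<close> a basis.\<close>

lemma degree_L: "degree (L k) \<le> k" and coeff_L: "coeff (L k) k \<noteq> 0"
proof -
  have "degree (L k) \<le> k \<and> coeff (L k) k \<noteq> 0"
  proof (induction k rule: L.induct)
    case (3 k)
    let ?q = "[:\<beta> + (1 + 1 / c) * real (k + 1), -\<kappa>:]"
    have "degree (?q * L (Suc k)) \<le> degree ?q + degree (L (Suc k))"
      by (rule degree_mult_le)
    also have "\<dots> \<le> Suc (Suc k)" using 3 by auto
    finally have "degree (?q * L (Suc k) - smult ((\<beta> + real k) / c) (L k)) \<le> Suc (Suc k)"
      using 3 order_trans[OF degree_smult_le] by (intro degree_diff_le) fastforce+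
    hence "degree (L (Suc (Suc k))) \<le> Suc (Suc k)"
      unfolding L.simps by (rule order_trans[OF degree_smult_le])
    moreover have "coeff (L (Suc (Suc k))) (Suc (Suc k)) = 1 / real (k + 2) * (- \<kappa> * coeff (L (Suc k)) (Suc k))"
      using 3 by (simp add: coeff_eq_0)
    ultimately show ?case using 3 kappa_pos by simp
  qed (use kappa_pos in auto)
  thus "degree (L k) \<le> k" "coeff (L k) k \<noteq> 0" by auto
qed

text \<open>
  In terms of the generating function \<open>G(x, t)\<close> this says \<open>(1 - t) G(x + 1, t) = (1 - t / c) G(x, t)\<close>;
  both sides are characterised by the same three-term recurrence in the coefficient index.
\<close>
lemma poly_L_shift:
  "poly (L (Suc k)) (x + 1) - poly (L k) (x + 1) = poly (L (Suc k)) x - poly (L k) x / c"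
proof (induction k rule: induct_nat_012)
  case 0
  have "1 / c = \<kappa> + 1" by (simp add: kappa_def)
  thus ?case by (simp add: algebra_simps)
next
  case 1
  define d where "d = 1 / c"
  define E where "E = poly (L (Suc (Suc 0))) (x + 1)"
  define l where "l = poly (L (Suc (Suc 0))) x"
  have E: "2 * E = (\<beta> + (1 + d) - \<kappa> * (x + 1)) * (\<beta> - \<kappa> * (x + 1)) - \<beta> * d"
    using poly_L_rec[of 0 "x + 1"] by (simp add: E_def d_def mult.commute del: L.simps(3))
  have l: "2 * l = (\<beta> + (1 + d) - \<kappa> * x) * (\<beta> - \<kappa> * x) - \<beta> * d"
    using poly_L_rec[of 0 x] by (simp add: l_def d_def mult.commute del: L.simps(3))
  have d: "d = \<kappa> + 1" by (simp add: kappa_def d_def)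
  have "2 * (E - (\<beta> - \<kappa> * (x + 1))) = 2 * (l - d * (\<beta> - \<kappa> * x))"
    unfolding right_diff_distrib[of 2] E l d by (simp add: algebra_simps)
  hence "E - (\<beta> - \<kappa> * (x + 1)) = l - d * (\<beta> - \<kappa> * x)"
    by (simp only: mult_cancel_left) simp
  thus ?case
    by (simp add: E_def l_def d_def mult.commute del: L.simps(3))
next
  case (ge2 k)
  define d where "d = 1 / c"
  define E where "E j = poly (L j) (x + 1)" for j
  define l where "l j = poly (L j) x" for j
  \<comment> \<open>\<open>P\<close> is the coefficient in the common recurrence
    \<open>(k + 3) u (k + 2) = P u (k + 1) - (\<beta> + k) d u k\<close> of both
    \<open>u j = E (j + 1) - E j\<close> and \<open>u j = l (j + 1) - d * l j\<close>.\<close>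
  define P where "P = (1 + d) * real (k + 2) - (d - 1) * x + \<beta> - d"
  have recE: "real (j + 2) * E (Suc (Suc j)) =
      (\<beta> + (1 + d) * real (j + 1) - (d - 1) * (x + 1)) * E (Suc j) - (\<beta> + real j) * d * E j" for j
    using poly_L_rec[of j "x + 1"] by (simp add: E_def d_def kappa_def del: L.simps)
  have recl: "real (j + 2) * l (Suc (Suc j)) =
      (\<beta> + (1 + d) * real (j + 1) - (d - 1) * x) * l (Suc j) - (\<beta> + real j) * d * l j" for j
    using poly_L_rec[of j x] by (simp add: l_def d_def kappa_def del: L.simps)
  have "real (k + 3) * (E (Suc (Suc (Suc k))) - E (Suc (Suc k))) =
      P * (E (Suc (Suc k)) - E (Suc k)) - (\<beta> + real k) * d * (E (Suc k) - E k)"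
    using recE[of k] recE[of "Suc k"] by (simp add: P_def algebra_simps)
  also have "\<dots> = P * (l (Suc (Suc k)) - d * l (Suc k)) - (\<beta> + real k) * d * (l (Suc k) - d * l k)"
    using ge2 by (simp add: E_def l_def d_def del: L.simps)
  also have "\<dots> = real (k + 3) * (l (Suc (Suc (Suc k))) - d * l (Suc (Suc k)))"
    using recl[of k] recl[of "Suc k"] arg_cong[OF recl[of k], of "\<lambda>y. d * y"]
    by (simp add: P_def algebra_simps)
  finally show ?case
    by (simp add: E_def l_def d_def del: L.simps)
qed

text \<open>As \<open>1 / c = \<kappa> + 1\<close>, the shift identity says that the forward
  difference of \<open>L (Suc k) - L k\<close> is \<open>- \<kappa>\<close> times
  \<open>L k\<close>, a form ready to telescope.\<close>

lemma pcompose_L_Suc_diff: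
  "pcompose (L (Suc k) - L k) [:1, 1:] = L (Suc k) - L k - smult \<kappa> (L k)"
proof (intro poly_ext)
  fix x
  show "poly (pcompose (L (Suc k) - L k) [:1, 1:]) x = poly (L (Suc k) - L k - smult \<kappa> (L k)) x"
    using poly_L_shift[of k x]
    by (simp add: poly_pcompose kappa_def algebra_simps del: L.simps)
qed

section \<open>Orthogonality of the Meixner polynomials\<close>

text \<open>Insert \<open>L (Suc k) - L k\<close>, whose shift is known, into the Pearson identity.
  The moments of \<open>x * L k\<close> cancel because \<open>c * \<kappa> = 1 - c\<close>.\<close>

lemma moment_x_L_Suc:
  "\<kappa> * moment ([:0, 1:] * L (Suc k)) = \<beta> * moment (L (Suc k)) - \<beta> / c * moment (L k)"
proof -
  define X where "X p = moment ([:0, 1:] * p)" for p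
  have lin: "moment ([:\<beta>, 1:] * p) = X p + \<beta> * moment p" for p
    using moment_add[of "[:0, 1:] * p" "smult \<beta> p"] by (simp add: X_def moment_smult add.commute)
  have X_diff: "X (p - q) = X p - X q" and X_smult: "X (smult a p) = a * X p" for p q a
    by (simp_all add: X_def right_diff_distrib moment_diff mult_smult_right moment_smult
        del: mult_pCons_left)
  have "X (L (Suc k)) - X (L k) = c * (X (L (Suc k)) - X (L k) - \<kappa> * X (L k) +
          \<beta> * (moment (L (Suc k)) - moment (L k) - \<kappa> * moment (L k)))"
    using moment_pearson[of "L (Suc k) - L k"]
    unfolding X_def[symmetric] pcompose_L_Suc_diff lin
    by (simp add: X_diff X_smult moment_diff moment_smult del: L.simps)
  also have "\<dots> = c * X (L (Suc k)) - c * X (L k) - (c * \<kappa>) * X (L k) +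
          \<beta> * (c * moment (L (Suc k)) - c * moment (L k) - (c * \<kappa>) * moment (L k))"
    by (simp add: algebra_simps del: L.simps)
  finally have "(c * \<kappa>) * X (L (Suc k)) = c * \<beta> * moment (L (Suc k)) - \<beta> * moment (L k)"
    unfolding c_kappa by (simp add: algebra_simps del: L.simps)
  thus ?thesis
    unfolding X_def[symmetric] using c_pos by (simp add: field_simps del: L.simps)
qed

lemma moment_x_0: "\<kappa> * moment ([:0, 1:] * L 0) = \<beta> * moment (L 0)"
proof -
  have "moment [:\<beta>, 1:] = moment [:0, 1:] + \<beta> * moment 1"
    using moment_add[of "[:0, 1:]" "smult \<beta> 1"] moment_smult[of \<beta> 1] by simp
  hence "(c * \<kappa>) * moment [:0, 1:] = c * (\<beta> * moment 1)"
    using moment_pearson[of 1] by (simp add: c_kappa pcompose_1 algebra_simps)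
  thus ?thesis using c_pos by simp
qed

text \<open>Here and in the next lemma the recurrence is paired with an arbitrary \<open>q\<close>,
  which later lets it act on either factor of a product.\<close>

lemma moment_L_1_mult:
  "moment (L (Suc 0) * q) = \<beta> * moment (L 0 * q) - \<kappa> * moment ([:0, 1:] * L 0 * q)"
proof -
  have "L (Suc 0) * q = smult \<beta> (L 0 * q) - smult \<kappa> ([:0, 1:] * L 0 * q)"
    by simp
  thus ?thesis by (simp only: moment_diff moment_smult)
qed

lemma moment_L_Suc_Suc_mult:
  "real (k + 2) * moment (L (Suc (Suc k)) * q) =
     (\<beta> + (1 + 1 / c) * real (k + 1)) * moment (L (Suc k) * q)
      - \<kappa> * moment ([:0, 1:] * L (Suc k) * q) - (\<beta> + real k) / c * moment (L k * q)"
proof -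
  have "smult (real (k + 2)) (L (Suc (Suc k)) * q) =
     smult (\<beta> + (1 + 1 / c) * real (k + 1)) (L (Suc k) * q)
      - smult \<kappa> ([:0, 1:] * L (Suc k) * q) - smult ((\<beta> + real k) / c) (L k * q)"
    unfolding mult_smult_left[symmetric] L_rec
    by (simp add: algebra_simps del: L.simps)
  from arg_cong[OF this, of moment] show ?thesis
    by (simp only: moment_diff moment_smult)
qed

lemma moment_L:
  assumes "k > 0"
  shows "moment (L k) = 0"
proof -
  \<comment> \<open>The factor \<open>j\<close> makes the first conjunct true at
    \<open>j = 0\<close>, where \<open>moment (L 0)\<close> itself is positive; it is also the
    factor left over when the two recurrences are combined.\<close>
  have "real j * moment (L j) = 0 \<and> moment (L (Suc j)) = 0" for j
  proof (induction j)
    case 0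
    show ?case using moment_L_1_mult[of 1] moment_x_0 by simp
  next
    case (Suc j)
    have "real (j + 2) * moment (L (Suc (Suc j))) = - (real j * moment (L j)) / c"
      using Suc moment_L_Suc_Suc_mult[of j 1] moment_x_L_Suc[of j]
      by (simp add: algebra_simps add_divide_distrib diff_divide_distrib del: L.simps)
    thus ?case using Suc by (simp del: L.simps)
  qed
  from this[of "k - 1"] show ?thesis using assms by simp
qed

text \<open>The squared norm of \<open>L k\<close>, as proved in
  \<open>moment_L_square\<close>.\<close>

definition h :: "nat \<Rightarrow> real" where
  "h k = moment 1 * (pochhammer \<beta> k / fact k) / c ^ k"

lemma h_pos: "h k > 0"
  using moment_1_pos c_pos \<beta>_pos by (simp add: h_def pochhammer_pos)

text \<open>These ratios are the radicands in \<open>B_entry\<close> and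
  \<open>C_entry\<close>.\<close>

lemma h_Suc: "h (Suc k) / h k = (\<beta> + real k) / (real (Suc k) * c)"
  using moment_1_pos c_pos \<beta>_pos pochhammer_pos[of \<beta> k]
  by (simp add: h_def pochhammer_Suc divide_simps)

text \<open>Multiplication by \<open>x\<close> is symmetric, so the three-term recurrence may be applied to either factor.\<close>
lemma moment_L_mult_less: "j < k \<Longrightarrow> moment (L j * L k) = 0"
proof (induction j arbitrary: k rule: induct_nat_012)
  case 0
  thus ?case using moment_L[of k] by simp
next
  case 1
  then obtain i where i: "k = Suc i" "i > 0" by (cases k) auto
  have "\<kappa> * moment ([:0, 1:] * L k * L 0) = 0"
    using moment_L_Suc_Suc_mult[of i "L 0"] moment_L[of i] moment_L[of "Suc i"] moment_L[of "Suc (Suc i)"] i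
    by (simp del: L.simps add: L.simps(1))
  thus ?case
    using moment_L_1_mult[of "L k"] moment_L[of k] i by (simp add: mult_ac del: L.simps(2,3))
next
  case (ge2 j)
  then obtain i where i: "k = Suc i" "i > Suc j" by (cases k) auto
  \<comment> \<open>Expanding \<open>x * L k\<close> gives the indices \<open>i\<close>,
    \<open>i + 1\<close> and \<open>i + 2\<close>, all above \<open>j + 1\<close>, so the induction
    hypothesis kills every term.\<close>
  have "\<kappa> * moment ([:0, 1:] * L k * L (Suc j)) = 0"
    using moment_L_Suc_Suc_mult[of i "L (Suc j)"] ge2(2)[of i] ge2(2)[of "Suc i"] ge2(2)[of "Suc (Suc i)"] i
    by (simp del: L.simps mult_pCons_left add: mult.commute[of "L (Suc j)"])
  hence "\<kappa> * moment ([:0, 1:] * L (Suc j) * L k) = 0"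
    by (simp only: mult_ac)
  hence "real (j + 2) * moment (L (Suc (Suc j)) * L k) = 0"
    using moment_L_Suc_Suc_mult[of j "L k"] ge2(1)[of k] ge2(2)[of k] i
    by (simp del: L.simps mult_pCons_left)
  thus ?case by (simp del: L.simps)
qed

text \<open>Evaluating the moment of \<open>x * L k * L (Suc k)\<close> by the recurrence in either
  factor expresses \<open>Suc k\<close> times the new squared norm through
  \<open>h k\<close>.\<close>

lemma moment_L_square: "moment (L k * L k) = h k"
proof (induction k)
  case 0
  show ?case by (simp add: h_def)
next
  case (Suc k)
  have zero: "moment (L j * L i) = 0" if "i \<noteq> j" for i j
    using that moment_L_mult_less[of i j] moment_L_mult_less[of j i]
    by (cases i j rule: linorder_cases) (auto simp: mult.commute)
  have "\<kappa> * moment ([:0, 1:] * L (Suc k) * L k) = - ((\<beta> + real k) / c * h k)"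
    using moment_L_Suc_Suc_mult[of k "L k"] zero[of k "Suc k"] zero[of k "Suc (Suc k)"] Suc
    by (simp del: L.simps mult_pCons_left)
  hence *: "\<kappa> * moment ([:0, 1:] * L k * L (Suc k)) = - ((\<beta> + real k) / c * h k)"
    by (simp only: mult_ac)
  have "real (Suc k) * moment (L (Suc k) * L (Suc k)) = (\<beta> + real k) / c * h k"
  proof (cases k)
    case 0
    thus ?thesis using * moment_L_1_mult[of "L (Suc 0)"] zero[of "Suc 0" 0]
      by (simp del: L.simps mult_pCons_left)
  next
    case (Suc i)
    thus ?thesis
      using * moment_L_Suc_Suc_mult[of i "L (Suc (Suc i))"] zero[of "Suc (Suc i)" i] zero[of "Suc (Suc i)" "Suc i"]
      by (simp del: L.simps mult_pCons_left)
  qed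
  also have "\<dots> = real (Suc k) * h (Suc k)"
  proof -
    have "h (Suc k) = (\<beta> + real k) / (real (Suc k) * c) * h k"
      using h_Suc[of k] h_pos[of k] by (metis less_irrefl nonzero_divide_eq_eq)
    thus ?thesis using c_pos by (simp del: of_nat_Suc)
  qed
  finally show ?case by (simp del: L.simps)
qed

lemma moment_L_mult: "moment (L j * L k) = (if j = k then h k else 0)"
  using moment_L_mult_less[of j k] moment_L_mult_less[of k j] moment_L_square[of k]
  by (cases j k rule: linorder_cases) (auto simp: mult.commute)

text \<open>Parseval's identity for the orthogonal system.\<close>

lemma moment_sum_L_square:
  assumes "finite I"
  shows "moment ((\<Sum>k\<in>I. smult (a k) (L k)) * (\<Sum>k\<in>I. smult (a k) (L k))) = (\<Sum>k\<in>I. h k * (a k)\<^sup>2)"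
proof -
  have "moment ((\<Sum>k\<in>I. smult (a k) (L k)) * (\<Sum>k\<in>I. smult (a k) (L k))) =
        (\<Sum>j\<in>I. \<Sum>k\<in>I. a j * (a k * moment (L j * L k)))"
    by (simp add: sum_product moment_sum moment_smult mult_ac)
  also have "\<dots> = (\<Sum>j\<in>I. h j * (a j)\<^sup>2)"
    using assms by (intro sum.cong) (auto simp: moment_L_mult power2_eq_square if_distrib cong: if_cong)
  finally show ?thesis .
qed

section \<open>Coordinates of polynomials and of their differences\<close>

text \<open>Leading terms are stripped off one degree at a time, since \<open>L k\<close> has exact
  degree \<open>k\<close>.\<close>

lemma poly_eq_sum_L:
  assumes "degree p \<le> n"
  obtains a where "p = (\<Sum>k\<le>n. smult (a k) (L k))"
  using assms
proof (induction n arbitrary: p thesis)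
  case 0
  then obtain x where "p = [:x:]" by (auto elim: degree_eq_zeroE)
  thus ?case by (intro 0(1)[of "\<lambda>_. x"]) simp
next
  case (Suc n)
  define b where "b = coeff p (Suc n) / coeff (L (Suc n)) (Suc n)"
  define q where "q = p - smult b (L (Suc n))"
  have "coeff q i = 0" if "i > n" for i
  proof (cases "i = Suc n")
    case True
    thus ?thesis using coeff_L[of "Suc n"] by (simp add: q_def b_def del: L.simps)
  next
    case False
    thus ?thesis using that Suc.prems(2) degree_L[of "Suc n"]
      by (simp add: q_def coeff_eq_0 del: L.simps)
  qed
  hence "degree q \<le> n" by (intro degree_le) auto
  then obtain a where a: "q = (\<Sum>k\<le>n. smult (a k) (L k))" using Suc.IH by blast
  have "p = q + smult b (L (Suc n))" by (simp add: q_def)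
  also have "q = (\<Sum>k\<le>n. smult ((a(Suc n := b)) k) (L k))"
    unfolding a by (intro sum.cong) auto
  also have "\<dots> + smult b (L (Suc n)) = (\<Sum>k\<le>Suc n. smult ((a(Suc n := b)) k) (L k))"
    by (simp del: L.simps)
  finally show ?case by (rule Suc.prems(1))
qed

text \<open>Telescoping of \<open>pcompose_L_Suc_diff\<close> from the constant
  \<open>L 0\<close>.\<close>

lemma pcompose_L: "pcompose (L k) [:1, 1:] = L k - (\<Sum>j<k. smult \<kappa> (L j))"
proof (induction k)
  case 0
  show ?case by (simp add: pcompose_1)
next
  case (Suc k)
  show ?case using Suc pcompose_L_Suc_diff[of k]
    by (simp add: pcompose_diff algebra_simps del: L.simps)
qed

text \<open>Exchanging the order of summation collects the coefficients of \<open>p\<close> into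
  tail sums.\<close>

lemma pcompose_sum_L:
  fixes a :: "nat \<Rightarrow> real" and n :: nat
  defines "p \<equiv> \<Sum>k\<le>n. smult (a k) (L k)"
  shows "pcompose p [:1, 1:] - p = (\<Sum>j<n. smult (- \<kappa> * (\<Sum>k\<in>{j<..n}. a k)) (L j))"
proof -
  have "pcompose p [:1, 1:] - p = (\<Sum>k\<le>n. smult (a k) (pcompose (L k) [:1, 1:] - L k))"
    by (simp add: p_def pcompose_sum pcompose_smult sum_subtractf smult_diff_right)
  also have "\<dots> = (\<Sum>k\<le>n. \<Sum>j\<in>{j \<in> {..<n}. j < k}. smult (- \<kappa> * a k) (L j))"
  proof (intro sum.cong refl)
    fix k assume "k \<in> {..n}"
    hence "{j \<in> {..<n}. j < k} = {..<k}" by auto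
    thus "smult (a k) (pcompose (L k) [:1, 1:] - L k) = (\<Sum>j\<in>{j \<in> {..<n}. j < k}. smult (- \<kappa> * a k) (L j))"
      by (simp add: pcompose_L smult_sum2 sum_negf[symmetric] mult_ac)
  qed
  also have "\<dots> = (\<Sum>j<n. \<Sum>k\<in>{k \<in> {..n}. j < k}. smult (- \<kappa> * a k) (L j))"
    by (intro sum.swap_restrict) auto
  also have "\<dots> = (\<Sum>j<n. smult (- \<kappa> * (\<Sum>k\<in>{j<..n}. a k)) (L j))"
  proof (intro sum.cong refl)
    fix j
    have "{k \<in> {..n}. j < k} = {j<..n}" by auto
    thus "(\<Sum>k\<in>{k \<in> {..n}. j < k}. smult (- \<kappa> * a k) (L j)) =
          smult (- \<kappa> * (\<Sum>k\<in>{j<..n}. a k)) (L j)"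
      by (simp add: smult_sum sum_distrib_left)
  qed
  finally show ?thesis .
qed

section \<open>Bidiagonal factorisation of the matrices\<close>

text \<open>
  If \<open>f = \<Sum>k\<le>n. a\<^sub>k L\<^sub>k\<close> and \<open>y\<^sub>j = sqrt (h j) (\<Sum>k>j. a\<^sub>k)\<close>, then \<open>-\<kappa> y\<close> is the vector of
  orthonormal coordinates of \<open>\<Delta>f\<close>, and \<open>bidiag n\<close> maps \<open>y\<close> to that of \<open>f - a\<^sub>0\<close>.
\<close>
definition bidiag :: "nat \<Rightarrow> real mat" where
  "bidiag n = mat n n (\<lambda>(i, j).
     if j = i then sqrt ((\<beta> + real i) / (real (Suc i) * c)) else if j = Suc i then -1 else 0)"

lemma bidiag_carrier [simp]: "bidiag n \<in> carrier_mat n n"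
  by (simp add: bidiag_def)

lemma sum_bidiag_row:
  assumes "i < n"
  shows "(\<Sum>j\<in>{0..<n}. f j * bidiag n $$ (i, j)) =
         f i * sqrt ((\<beta> + real i) / (real (Suc i) * c)) - (if Suc i < n then f (Suc i) else 0)"
proof -
  have "(\<Sum>j\<in>{0..<n}. f j * bidiag n $$ (i, j)) =
        (\<Sum>j\<in>{0..<n}. (if j = i then f i * sqrt ((\<beta> + real i) / (real (Suc i) * c)) else 0) -
                       (if j = Suc i then f (Suc i) else 0))"
    using assms by (intro sum.cong) (auto simp: bidiag_def)
  thus ?thesis using assms by (simp add: sum_subtractf)
qed

lemma sum_bidiag_col:
  assumes "j < n"
  shows "(\<Sum>i\<in>{0..<n}. f i * bidiag n $$ (i, j)) =
         f j * sqrt ((\<beta> + real j) / (real (Suc j) * c)) - (if j > 0 then f (j - 1) else 0)"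
proof -
  \<comment> \<open>Natural subtraction sends \<open>j = 0\<close> to index 0, so the inner test
    \<open>j > 0\<close> is what removes the term there.\<close>
  have "(\<Sum>i\<in>{0..<n}. f i * bidiag n $$ (i, j)) =
        (\<Sum>i\<in>{0..<n}. (if i = j then f j * sqrt ((\<beta> + real j) / (real (Suc j) * c)) else 0) -
                       (if i = j - 1 then if j > 0 then f (j - 1) else 0 else 0))"
    using assms by (intro sum.cong) (auto simp: bidiag_def)
  thus ?thesis using assms by (simp add: sum_subtractf)
qed

text \<open>Column 0 of \<open>bidiag n\<close> contains no \<open>-1\<close>, which explains the
  exceptional first diagonal entry of \<open>C_mat\<close>.\<close>

lemma C_mat_eq: "C_mat n c \<beta> = transpose_mat (bidiag n) * bidiag n"
proof (rule eq_matI)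
  fix i j assume "i < dim_row (transpose_mat (bidiag n) * bidiag n)"
    "j < dim_col (transpose_mat (bidiag n) * bidiag n)"
  hence ij: "i < n" "j < n" by (auto simp: bidiag_def)
  have "(transpose_mat (bidiag n) * bidiag n) $$ (i, j) =
        (\<Sum>k\<in>{0..<n}. bidiag n $$ (k, i) * bidiag n $$ (k, j))"
    using ij by (simp add: scalar_prod_def bidiag_def)
  also have "\<dots> = C_mat n c \<beta> $$ (i, j)"
    unfolding sum_bidiag_col[OF ij(2)] using ij c_pos \<beta>_pos
    by (auto simp: C_mat_def C_entry_def bidiag_def)
  finally show "C_mat n c \<beta> $$ (i, j) = (transpose_mat (bidiag n) * bidiag n) $$ (i, j)" ..
qed (auto simp: C_mat_def bidiag_def)

text \<open>Here the last row, which contains no \<open>-1\<close>, produces the exceptional last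
  diagonal entry of \<open>B_mat\<close>.\<close>

lemma B_mat_eq: "B_mat n c \<beta> = bidiag n * transpose_mat (bidiag n)"
proof (rule eq_matI)
  fix i j assume "i < dim_row (bidiag n * transpose_mat (bidiag n))"
    "j < dim_col (bidiag n * transpose_mat (bidiag n))"
  hence ij: "i < n" "j < n" by (auto simp: bidiag_def)
  have "(bidiag n * transpose_mat (bidiag n)) $$ (i, j) =
        (\<Sum>k\<in>{0..<n}. bidiag n $$ (i, k) * bidiag n $$ (j, k))"
    using ij by (simp add: scalar_prod_def bidiag_def)
  also have "\<dots> = B_mat n c \<beta> $$ (i, j)"
    unfolding sum_bidiag_row[OF ij(2)] using ij c_pos \<beta>_pos
    by (auto simp: B_mat_def B_entry_def bidiag_def add_ac)
  finally show "B_mat n c \<beta> $$ (i, j) = (bidiag n * transpose_mat (bidiag n)) $$ (i, j)" ..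
qed (auto simp: B_mat_def bidiag_def)

lemma det_bidiag: "det (bidiag n) \<noteq> 0"
proof -
  have "upper_triangular (bidiag n)" by (auto simp: bidiag_def)
  hence "det (bidiag n) = prod_list (diag_mat (bidiag n))"
    by (rule det_upper_triangular[OF _ bidiag_carrier])
  also have "\<dots> \<noteq> 0"
    using c_pos \<beta>_pos by (auto simp: prod_list_zero_iff diag_mat_def bidiag_def add_pos_nonneg)
  finally show ?thesis .
qed

lemma det_C_mat: "det (C_mat n c \<beta>) \<noteq> 0"
proof -
  have D: "transpose_mat (bidiag n) \<in> carrier_mat n n" by simp
  show ?thesis
    using det_bidiag[of n] unfolding C_mat_eq
    by (simp add: det_mult[OF D bidiag_carrier] det_transpose[OF bidiag_carrier])
qed

lemma eigenvalue_B_mat_iff: "eigenvalue (B_mat n c \<beta>) \<mu> \<longleftrightarrow> eigenvalue (C_mat n c \<beta>) \<mu>"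
  unfolding B_mat_eq C_mat_eq
  using eigenvalue_mult_commute_iff[of "transpose_mat (bidiag n)" n "bidiag n" \<mu>] det_C_mat[of n]
  by (simp add: C_mat_eq)

section \<open>Meixner norms as quadratic forms\<close>

lemma scalar_prod_C_mat:
  assumes "y \<in> carrier_vec n"
  shows "y \<bullet> (C_mat n c \<beta> *\<^sub>v y) = (bidiag n *\<^sub>v y) \<bullet> (bidiag n *\<^sub>v y)"
proof -
  have D: "transpose_mat (bidiag n) \<in> carrier_mat n n" by simp
  have Dy: "bidiag n *\<^sub>v y \<in> carrier_vec n"
    using assms by (rule mult_mat_vec_carrier[OF bidiag_carrier])
  have "y \<bullet> (C_mat n c \<beta> *\<^sub>v y) = y \<bullet> (transpose_mat (bidiag n) *\<^sub>v (bidiag n *\<^sub>v y))"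
    unfolding C_mat_eq using assms by (simp add: assoc_mult_mat_vec[OF D bidiag_carrier])
  also have "\<dots> = (bidiag n *\<^sub>v y) \<bullet> (bidiag n *\<^sub>v y)"
    using transpose_vec_mult_scalar[OF D Dy assms] by simp
  finally show ?thesis .
qed

lemma bidiag_mult_vec:
  assumes "y \<in> carrier_vec n" "i < n"
  shows "(bidiag n *\<^sub>v y) $ i = sqrt (h (Suc i) / h i) * y $ i - (if Suc i < n then y $ Suc i else 0)"
proof -
  have "(bidiag n *\<^sub>v y) $ i = (\<Sum>j\<in>{0..<n}. y $ j * bidiag n $$ (i, j))"
    using assms by (simp add: scalar_prod_def bidiag_def mult.commute)
  thus ?thesis
    unfolding sum_bidiag_row[OF assms(2)] h_Suc by (simp add: mult.commute)
qed

lemma moments_sum_L: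
  fixes a :: "nat \<Rightarrow> real" and n :: nat
  defines "p \<equiv> \<Sum>k\<le>n. smult (a k) (L k)"
  defines "\<Delta>p \<equiv> pcompose p [:1, 1:] - p"
  defines "y \<equiv> vec n (\<lambda>j. sqrt (h j) * (\<Sum>k\<in>{j<..n}. a k))"
  shows "moment (p * p) = h 0 * (a 0)\<^sup>2 + (bidiag n *\<^sub>v y) \<bullet> (bidiag n *\<^sub>v y)"
    and "moment (\<Delta>p * \<Delta>p) = \<kappa>\<^sup>2 * (y \<bullet> y)"
proof -
  have y: "y \<in> carrier_vec n" by (simp add: y_def)
  \<comment> \<open>The square root replaces \<open>h i\<close> by \<open>h (Suc i)\<close> in
    \<open>y $ i\<close>, so that consecutive tail sums carry the same factor and differ by
    \<open>a (Suc i)\<close>; for \<open>i = n - 1\<close> the second tail sum is empty.\<close>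
  have Dy: "(bidiag n *\<^sub>v y) $ i = sqrt (h (Suc i)) * a (Suc i)" if "i < n" for i
  proof -
    have "sqrt (h (Suc i) / h i) * y $ i = sqrt (h (Suc i)) * (\<Sum>k\<in>{i<..n}. a k)"
      using h_pos[of i] that by (simp add: y_def real_sqrt_divide)
    also have "{i<..n} = insert (Suc i) {Suc i<..n}" using that by auto
    finally have "sqrt (h (Suc i) / h i) * y $ i =
        sqrt (h (Suc i)) * a (Suc i) + sqrt (h (Suc i)) * (\<Sum>k\<in>{Suc i<..n}. a k)"
      by (simp add: distrib_left)
    thus ?thesis
      unfolding bidiag_mult_vec[OF y that] by (simp add: y_def)
  qed
  have "(bidiag n *\<^sub>v y) \<bullet> (bidiag n *\<^sub>v y) = (\<Sum>i\<in>{0..<n}. (sqrt (h (Suc i)) * a (Suc i))\<^sup>2)"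
    using Dy
    by (simp add: scalar_prod_def power2_eq_square carrier_matD(1)[OF bidiag_carrier]
        del: index_mult_mat_vec)
  also have "\<dots> = (\<Sum>i<n. h (Suc i) * (a (Suc i))\<^sup>2)"
    using h_pos by (simp add: power_mult_distrib less_imp_le atLeast0LessThan)
  finally show "moment (p * p) = h 0 * (a 0)\<^sup>2 + (bidiag n *\<^sub>v y) \<bullet> (bidiag n *\<^sub>v y)"
    unfolding p_def moment_sum_L_square[OF finite_atMost] by (simp only: sum.atMost_shift)
  have "\<Delta>p = (\<Sum>j<n. smult (- \<kappa> * (\<Sum>k\<in>{j<..n}. a k)) (L j))"
    unfolding \<Delta>p_def p_def by (rule pcompose_sum_L)
  hence "moment (\<Delta>p * \<Delta>p) = (\<Sum>j<n. h j * (- \<kappa> * (\<Sum>k\<in>{j<..n}. a k))\<^sup>2)"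
    by (simp only: moment_sum_L_square finite_lessThan)
  also have "\<dots> = \<kappa>\<^sup>2 * (\<Sum>j<n. (sqrt (h j) * (\<Sum>k\<in>{j<..n}. a k))\<^sup>2)"
    unfolding sum_distrib_left[of "\<kappa>\<^sup>2"] using h_pos
    by (intro sum.cong) (simp_all add: power_mult_distrib less_imp_le)
  also have "(\<Sum>j<n. (sqrt (h j) * (\<Sum>k\<in>{j<..n}. a k))\<^sup>2) = y \<bullet> y"
    by (simp add: scalar_prod_def y_def power2_eq_square atLeast0LessThan)
  finally show "moment (\<Delta>p * \<Delta>p) = \<kappa>\<^sup>2 * (y \<bullet> y)" .
qed

lemma fwd_diff_poly: "fwd_diff (poly p) = poly (pcompose p [:1, 1:] - p)"
  by (auto simp: fwd_diff_def poly_pcompose add.commute)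

text \<open>Constants have zero difference, so only the norm of \<open>f\<close> sees
  \<open>a 0\<close>; dropping the term \<open>h 0 * (a 0)\<^sup>2\<close> gives the
  inequality.\<close>

lemma meixner_norms_le_scalar_prod:
  assumes "f \<in> poly_space n"
  obtains y where "y \<in> carrier_vec n"
    "meixner_norm c \<beta> f \<ge> sqrt (y \<bullet> (C_mat n c \<beta> *\<^sub>v y))"
    "meixner_norm c \<beta> (fwd_diff f) = \<kappa> * sqrt (y \<bullet> y)"
proof -
  obtain p where p: "f = poly p" "degree p \<le> n" using assms by (auto simp: poly_space_def)
  obtain a where a: "p = (\<Sum>k\<le>n. smult (a k) (L k))" using poly_eq_sum_L[OF p(2)] by blast
  define y where "y = vec n (\<lambda>j. sqrt (h j) * (\<Sum>k\<in>{j<..n}. a k))"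
  have y: "y \<in> carrier_vec n" by (simp add: y_def)
  show ?thesis
  proof (rule that[OF y])
    show "meixner_norm c \<beta> f \<ge> sqrt (y \<bullet> (C_mat n c \<beta> *\<^sub>v y))"
      using moments_sum_L(1)[of a n] h_pos[of 0]
      unfolding p meixner_norm_poly scalar_prod_C_mat[OF y] unfolding a y_def by simp
    show "meixner_norm c \<beta> (fwd_diff f) = \<kappa> * sqrt (y \<bullet> y)"
      using moments_sum_L(2)[of a n] kappa_pos
      unfolding p fwd_diff_poly meixner_norm_poly a y_def by (simp add: real_sqrt_mult)
  qed
qed

text \<open>Conversely every vector comes from a polynomial, and the choice \<open>a 0 = 0\<close>
  turns the inequality into an equality.\<close>

lemma meixner_norms_eq_scalar_prod:
  assumes y: "y \<in> carrier_vec n"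
  obtains p where "degree p \<le> n"
    "meixner_norm c \<beta> (poly p) = sqrt (y \<bullet> (C_mat n c \<beta> *\<^sub>v y))"
    "meixner_norm c \<beta> (fwd_diff (poly p)) = \<kappa> * sqrt (y \<bullet> y)"
proof -
  \<comment> \<open>\<open>s\<close> prescribes the tail sums and vanishes from \<open>n\<close> on;
    \<open>a\<close> consists of its successive drops, so that its tail sums telescope to
    \<open>s j\<close>.\<close>
  define s where "s j = (if j < n then y $ j / sqrt (h j) else 0)" for j
  define a where "a k = (if k = 0 then 0 else s (k - 1) - s k)" for k
  define p where "p = (\<Sum>k\<le>n. smult (a k) (L k))"
  have "sqrt (h j) * (\<Sum>k\<in>{j<..n}. a k) = y $ j" if "j < n" for j
  proof -
    have "(\<Sum>k\<in>{j<..n}. a k) = (\<Sum>k\<in>{Suc j..n}. - s k - - s (k - 1))"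
      by (intro sum.cong) (auto simp: a_def)
    also have "\<dots> = s j" using that by (subst sum_telescope'') (auto simp: s_def)
    finally show ?thesis using that h_pos[of j] by (simp add: s_def)
  qed
  hence y_eq: "vec n (\<lambda>j. sqrt (h j) * (\<Sum>k\<in>{j<..n}. a k)) = y"
    using y by (intro eq_vecI) auto
  show ?thesis
  proof (rule that)
    show "degree p \<le> n"
      unfolding p_def
      by (intro degree_sum_le) (auto intro: order_trans[OF degree_smult_le] order_trans[OF degree_L])
    show "meixner_norm c \<beta> (poly p) = sqrt (y \<bullet> (C_mat n c \<beta> *\<^sub>v y))"
      using moments_sum_L(1)[of a n]
      unfolding y_eq p_def[symmetric] meixner_norm_poly scalar_prod_C_mat[OF y] by (simp add: a_def)
    show "meixner_norm c \<beta> (fwd_diff (poly p)) = \<kappa> * sqrt (y \<bullet> y)"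
      using moments_sum_L(2)[of a n] kappa_pos
      unfolding y_eq p_def[symmetric] fwd_diff_poly meixner_norm_poly by (simp add: real_sqrt_mult)
  qed
qed

section \<open>The extremal problem\<close>

text \<open>The factorisation makes the quadratic form a sum of squares, so
  \<open>l \<ge> 0\<close>, and the nonzero determinant excludes 0.\<close>

lemma C_mat_min_eigenvalue:
  assumes "n > 0"
  obtains l v where "l > 0" "eigenvector (C_mat n c \<beta>) v l"
    "\<And>y. y \<in> carrier_vec n \<Longrightarrow> l * (y \<bullet> y) \<le> y \<bullet> (C_mat n c \<beta> *\<^sub>v y)"
proof -
  have C: "C_mat n c \<beta> \<in> carrier_mat n n" by (simp add: C_mat_def)
  have "transpose_mat (C_mat n c \<beta>) = C_mat n c \<beta>"
    unfolding C_mat_eq by (subst transpose_mult[of _ n n _ n]) simp_all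
  then obtain l v where ev: "eigenvector (C_mat n c \<beta>) v l" and
    min: "\<And>y. y \<in> carrier_vec n \<Longrightarrow> l * (y \<bullet> y) \<le> y \<bullet> (C_mat n c \<beta> *\<^sub>v y)"
    using symmetric_mat_min_eigenvalue[OF C _ assms] by metis
  have v: "v \<in> carrier_vec n" "v \<noteq> 0\<^sub>v n" "C_mat n c \<beta> *\<^sub>v v = l \<cdot>\<^sub>v v"
    using ev C by (auto simp: eigenvector_def)
  have "l * (v \<bullet> v) = v \<bullet> (C_mat n c \<beta> *\<^sub>v v)" using v by simp
  also have "\<dots> \<ge> 0" unfolding scalar_prod_C_mat[OF v(1)] by (rule scalar_prod_self_nonneg)
  finally have "l \<ge> 0" using scalar_prod_self_pos[OF v(1,2)] by (simp add: zero_le_mult_iff)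
  moreover have "l \<noteq> 0" using not_eigenvalue_0[OF C det_C_mat] ev by (auto simp: eigenvalue_def)
  ultimately have "l > 0" by simp
  thus ?thesis using ev min by (rule that)
qed

lemma meixner_norm_fwd_diff_le:
  assumes l: "l > 0" and min: "\<And>y. y \<in> carrier_vec n \<Longrightarrow> l * (y \<bullet> y) \<le> y \<bullet> (C_mat n c \<beta> *\<^sub>v y)"
    and f: "f \<in> poly_space n"
  shows "meixner_norm c \<beta> (fwd_diff f) \<le> \<kappa> / sqrt l * meixner_norm c \<beta> f"
proof -
  obtain y where y: "y \<in> carrier_vec n"
    "meixner_norm c \<beta> f \<ge> sqrt (y \<bullet> (C_mat n c \<beta> *\<^sub>v y))"
    "meixner_norm c \<beta> (fwd_diff f) = \<kappa> * sqrt (y \<bullet> y)"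
    by (rule meixner_norms_le_scalar_prod[OF f])
  have "sqrt l * sqrt (y \<bullet> y) \<le> meixner_norm c \<beta> f"
    using min[OF y(1)] y(2) unfolding real_sqrt_mult[symmetric]
    by (rule order_trans[OF real_sqrt_le_mono])
  hence "\<kappa> / sqrt l * (sqrt l * sqrt (y \<bullet> y)) \<le> \<kappa> / sqrt l * meixner_norm c \<beta> f"
    using kappa_pos l by (intro mult_left_mono) auto
  thus ?thesis using l y(3) by simp
qed

text \<open>The polynomial belonging to a suitable multiple of the eigenvector is extremal.\<close>

lemma meixner_norm_fwd_diff_attained:
  assumes l: "l > 0" and ev: "eigenvector (C_mat n c \<beta>) v l"
  obtains f where "f \<in> poly_space n" "meixner_norm c \<beta> f = 1"
    "meixner_norm c \<beta> (fwd_diff f) = \<kappa> / sqrt l"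
proof -
  have C: "C_mat n c \<beta> \<in> carrier_mat n n" by (simp add: C_mat_def)
  have v: "v \<in> carrier_vec n" "v \<noteq> 0\<^sub>v n" "C_mat n c \<beta> *\<^sub>v v = l \<cdot>\<^sub>v v"
    using ev C by (auto simp: eigenvector_def)
  have pos: "v \<bullet> v > 0" using v by (intro scalar_prod_self_pos)
  obtain y where y: "y \<in> carrier_vec n" "y \<bullet> y = 1 / l" "y \<bullet> (C_mat n c \<beta> *\<^sub>v y) = 1"
  proof
    \<comment> \<open>Chosen so that the quadratic form at the scaled vector, which is
      \<open>t * t * l * (v \<bullet> v)\<close>, equals 1.\<close>
    define t where "t = 1 / sqrt (l * (v \<bullet> v))"
    have t: "t * (t * (v \<bullet> v)) = 1 / l"
      using pos l by (simp add: t_def)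
    show "t \<cdot>\<^sub>v v \<in> carrier_vec n" using v by simp
    show "(t \<cdot>\<^sub>v v) \<bullet> (t \<cdot>\<^sub>v v) = 1 / l" using t by simp
    have "(t \<cdot>\<^sub>v v) \<bullet> (C_mat n c \<beta> *\<^sub>v (t \<cdot>\<^sub>v v)) = l * (t * (t * (v \<bullet> v)))"
      using v by (simp add: mult_mat_vec[OF C])
    thus "(t \<cdot>\<^sub>v v) \<bullet> (C_mat n c \<beta> *\<^sub>v (t \<cdot>\<^sub>v v)) = 1" using t l by simp
  qed
  obtain p where "degree p \<le> n"
    "meixner_norm c \<beta> (poly p) = sqrt (y \<bullet> (C_mat n c \<beta> *\<^sub>v y))"
    "meixner_norm c \<beta> (fwd_diff (poly p)) = \<kappa> * sqrt (y \<bullet> y)"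
    by (rule meixner_norms_eq_scalar_prod[OF y(1)])
  thus ?thesis
    using y by (intro that[of "poly p"]) (auto simp: poly_space_def real_sqrt_divide)
qed

lemma tridiagonal_B_mat: "tridiagonal (B_mat n c \<beta>)"
  and tridiagonal_C_mat: "tridiagonal (C_mat n c \<beta>)"
  by (auto simp: tridiagonal_def B_mat_def B_entry_def C_mat_def C_entry_def)

end

theorem theorem4p1:
  fixes c \<beta> :: real and n :: nat
  assumes "0 < c" and "c < 1" and "\<beta> > 0" and "n \<ge> 1"
  shows "(\<forall>p \<in> poly_space n.
            meixner_norm c \<beta> (fwd_diff p) \<le> markov_bernstein_const n c \<beta> * meixner_norm c \<beta> p) \<and>
         (\<exists>lam > 0.
            (\<forall>A \<in> {B_mat n c \<beta>, negate_offdiag (B_mat n c \<beta>),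
                  C_mat n c \<beta>, negate_offdiag (C_mat n c \<beta>)}. smallest_eigenvalue A lam) \<and>
            markov_bernstein_const n c \<beta> = (1 / c - 1) / sqrt lam)"
proof -
  interpret meixner c \<beta> using assms by unfold_locales auto
  have C: "C_mat n c \<beta> \<in> carrier_mat n n" and B: "B_mat n c \<beta> \<in> carrier_mat n n"
    by (simp_all add: C_mat_def B_mat_def)
  have "n > 0" using assms(4) by simp
  then obtain l v where l: "l > 0" and ev: "eigenvector (C_mat n c \<beta>) v l" and
    min: "\<And>y. y \<in> carrier_vec n \<Longrightarrow> l * (y \<bullet> y) \<le> y \<bullet> (C_mat n c \<beta> *\<^sub>v y)"
    using C_mat_min_eigenvalue by metis
  \<comment> \<open>At an eigenvector the Rayleigh quotient equals \<open>\<mu>\<close>, and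
    \<open>l\<close> bounds it from below.\<close>
  have "l \<le> \<mu>" if \<mu>: "eigenvalue (C_mat n c \<beta>) \<mu>" for \<mu>
  proof -
    obtain u where u: "u \<in> carrier_vec n" "u \<noteq> 0\<^sub>v n" "C_mat n c \<beta> *\<^sub>v u = \<mu> \<cdot>\<^sub>v u"
      using \<mu> C by (auto simp: eigenvalue_def eigenvector_def)
    hence "l * (u \<bullet> u) \<le> \<mu> * (u \<bullet> u)" using min[OF u(1)] by simp
    thus ?thesis using scalar_prod_self_pos[OF u(1,2)] by simp
  qed
  hence "smallest_eigenvalue (C_mat n c \<beta>) l"
    using ev by (auto simp: smallest_eigenvalue_def eigenvalue_def)
  hence "\<forall>A \<in> {B_mat n c \<beta>, negate_offdiag (B_mat n c \<beta>),
               C_mat n c \<beta>, negate_offdiag (C_mat n c \<beta>)}. smallest_eigenvalue A l"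
    unfolding smallest_eigenvalue_def ball_simps
      eigenvalue_negate_offdiag_iff[OF B tridiagonal_B_mat]
      eigenvalue_negate_offdiag_iff[OF C tridiagonal_C_mat] eigenvalue_B_mat_iff
    by blast
  \<comment> \<open>The supremum is a maximum, so the real-valued \<open>Sup\<close> is meaningful
    here.\<close>
  moreover have const: "markov_bernstein_const n c \<beta> = \<kappa> / sqrt l"
    unfolding markov_bernstein_const_def
  proof (rule cSup_eq_maximum)
    obtain f where "f \<in> poly_space n" "meixner_norm c \<beta> f = 1"
      "meixner_norm c \<beta> (fwd_diff f) = \<kappa> / sqrt l"
      by (rule meixner_norm_fwd_diff_attained[OF l ev])
    thus "\<kappa> / sqrt l \<in> {meixner_norm c \<beta> (fwd_diff f) |f. f \<in> poly_space n \<and> meixner_norm c \<beta> f = 1}"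
      by (metis (mono_tags, lifting) mem_Collect_eq)
  next
    fix x assume "x \<in> {meixner_norm c \<beta> (fwd_diff f) |f. f \<in> poly_space n \<and> meixner_norm c \<beta> f = 1}"
    then obtain f where "x = meixner_norm c \<beta> (fwd_diff f)" "f \<in> poly_space n" "meixner_norm c \<beta> f = 1"
      by blast
    thus "x \<le> \<kappa> / sqrt l" using meixner_norm_fwd_diff_le[OF l min, of f] by simp
  qed
  moreover have "\<forall>p \<in> poly_space n.
      meixner_norm c \<beta> (fwd_diff p) \<le> markov_bernstein_const n c \<beta> * meixner_norm c \<beta> p"
    unfolding const using meixner_norm_fwd_diff_le[OF l min] by blast
  ultimately show ?thesis
    using l unfolding kappa_def by blast
qed

end
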